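(* Let $T$ be a consistent RE theory. For any $n\geq1$, if $T$ is $(n+1)$-Rosser, then $T$ is effectively $n$-Rosser.
   Context: A fixed Gödel numbering of formulas is used. ${\sf Num}$ is the theory in the language $\{\mathbf 0,\mathbf S\}$ with axioms $\overline m\neq\overline n$ for $m\neq n$, where $\overline 0=\mathbf 0$, $\overline{k+1}=\mathbf S\overline k$. An interpretation $I:{\sf Num}\unlhd T$ is a translation of the language of ${\sf Num}$ into that of $T$ such that $T$ proves totality of translated function symbols on the domain, the translations of all theorems of ${\sf Num}$ and of the equality axioms; $\overline a^I$ is the $I$-translation of $\overline a$. If $T$ is a relational extension of ${\sf Num}$, $I$ is the identity. $\langle R^n_i\rangle$ is an acceptable enumeration of $n$-ary RE relations. A formula $\phi(x_1,\dots,x_k)$ with exactly $k$ free variables strongly separates $k$-ary relations $M_1$ from $M_2$ in $T$ w.r.t. $I$ if $\vec a\in M_1\Rightarrow T\vdash\phi(\overline{a_1}^I,\dots,\overline{a_k}^I)$ and $\vec a\in M_2\Rightarrow T\vdash\neg\phi(\overline{a_1}^I,\dots,\overline{a_k}^I)$. $T$ is $k$-Rosser if there is $I:{\sf Num}\unlhd T$ such that for every pair of $k$-ary RE relations $M_1,M_2$ some formula strongly separates $M_1\setminus M_2$ from $M_2\setminus M_1$ w.r.t. $I$. $T$ is effectively $n$-Rosser if there are $I$ and a recursive $f$ such that for all $i,j$, $f(i,j)$ codes a formula with exactly $n$ free variables strongly separating $R^n_i\setminus R^n_j$ from $R^n_j\setminus R^n_i$ w.r.t. $I$. *)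

theory Defs
  imports Main "HOL-Library.Nat_Bijection"
begin

section \<open>Partial recursive functions and RE relations\<close>

text \<open>
  Programs for the partial recursive functions and their input/output relation. Programs carry no
  arity: the arity is the length of the argument list. A program applied to a list of
  unsuitable length simply has no value, so that on the lists of any given length \<open>k\<close> exactly the
  \<open>k\<close>-ary partial recursive functions arise.
\<close>

datatype prog =
    Zero | Succ | Proj nat | Comp prog "prog list" | Prim prog prog | Mu prog

inductive computes :: "prog \<Rightarrow> nat list \<Rightarrow> nat \<Rightarrow> bool" where
  Zero: "computes Zero xs 0"
| Succ: "computes Succ [x] (Suc x)"
| Proj: "i < length xs \<Longrightarrow> computes (Proj i) xs (xs ! i)"
| Comp: "\<lbrakk> length ys = length ps; \<And>i. i < length ps \<Longrightarrow> computes (ps ! i) xs (ys ! i);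
           computes p ys z \<rbrakk> \<Longrightarrow> computes (Comp p ps) xs z"
| Prim0: "computes p xs z \<Longrightarrow> computes (Prim p q) (0 # xs) z"
| PrimS: "\<lbrakk> computes (Prim p q) (n # xs) y; computes q (n # y # xs) z \<rbrakk>
           \<Longrightarrow> computes (Prim p q) (Suc n # xs) z"
| Mu: "\<lbrakk> computes p (n # xs) 0; \<And>m. m < n \<Longrightarrow> computes p (m # xs) (Suc (h m)) \<rbrakk>
           \<Longrightarrow> computes (Mu p) xs n"

lemma computes_deterministic: "computes p xs y \<Longrightarrow> computes p xs z \<Longrightarrow> y = z"
proof (induction arbitrary: z rule: computes.induct)
  case (Zero xs) then show ?case by (auto elim: computes.cases)
next
  case (Succ x) then show ?case by (auto elim: computes.cases)
next
  case (Proj i xs) then show ?case by (auto elim: computes.cases)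
next
  case (Comp ys ps xs p z z')
  from Comp.prems obtain ys' where ys': "length ys' = length ps"
    "\<And>i. i < length ps \<Longrightarrow> computes (ps ! i) xs (ys' ! i)" "computes p ys' z'"
    by (auto elim: computes.cases)
  have "ys = ys'"
    by (rule nth_equalityI) (use Comp ys' in auto)
  with ys' Comp show ?case by blast
next
  case (Prim0 p xs z q z')
  from Prim0.prems have "computes p xs z'" by (cases rule: computes.cases) auto
  with Prim0 show ?case by blast
next
  case (PrimS p q n xs y z z')
  from PrimS.prems obtain y' where "computes (Prim p q) (n # xs) y'" "computes q (n # y' # xs) z'"
    by (cases rule: computes.cases) auto
  with PrimS show ?case by blast
next
  case (Mu p n xs h n')
  from Mu.prems obtain h' where h': "computes p (n' # xs) 0"
    "\<And>m. m < n' \<Longrightarrow> computes p (m # xs) (Suc (h' m))"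
    by (cases rule: computes.cases) auto
  show ?case
  proof (rule ccontr)
    assume "n \<noteq> n'"
    then consider "n < n'" | "n' < n" by linarith
    then show False
      by cases (use Mu.IH h' in force)+
  qed
qed

definition recursive_fun :: "nat \<Rightarrow> (nat list \<Rightarrow> nat) \<Rightarrow> bool" where
  "recursive_fun k f \<longleftrightarrow> (\<exists>p. \<forall>xs. length xs = k \<longrightarrow> computes p xs (f xs))"

definition re_rel :: "nat \<Rightarrow> nat list set \<Rightarrow> bool" where
  "re_rel k M \<longleftrightarrow> (\<exists>p. M = {xs. length xs = k \<and> (\<exists>y. computes p xs y)})"

text \<open>
  \<open>R n i\<close> is the \<open>i\<close>-th \<open>n\<close>-ary RE relation. Acceptability in the sense of Rogers and Smullyan:
  the enumeration theorem and the iteration (s-m-n) theorem hold.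
\<close>

definition acceptable_enumeration :: "(nat \<Rightarrow> nat \<Rightarrow> nat list set) \<Rightarrow> bool" where
  "acceptable_enumeration R \<longleftrightarrow>
     (\<forall>n\<ge>1. range (R n) = {M. re_rel n M}) \<and>
     (\<forall>n\<ge>1. re_rel (Suc n) {i # xs | i xs. xs \<in> R n i}) \<and>
     (\<forall>m\<ge>1. \<forall>n\<ge>1. \<exists>s. recursive_fun (Suc m) s \<and>
        (\<forall>i xs ys. length xs = m \<longrightarrow> length ys = n \<longrightarrow>
           (ys \<in> R n (s (i # xs)) \<longleftrightarrow> xs @ ys \<in> R (m + n) i)))"

section \<open>First-order logic with equality\<close>

text \<open>
  Variables are de Bruijn indices. A symbol is a name together with an arity; the arity of an
  occurrence of a symbol is the length of its argument list.
\<close>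

datatype tm = Var nat | Fn nat "tm list"

datatype fm = Fls | Eq tm tm | Rel nat "tm list" | Imp fm fm | Forall fm

abbreviation Neg :: "fm \<Rightarrow> fm" where "Neg \<phi> \<equiv> Imp \<phi> Fls"
abbreviation And :: "fm \<Rightarrow> fm \<Rightarrow> fm" where "And \<phi> \<psi> \<equiv> Neg (Imp \<phi> (Neg \<psi>))"
abbreviation Exists :: "fm \<Rightarrow> fm" where "Exists \<phi> \<equiv> Neg (Forall (Neg \<phi>))"

primrec subst_tm :: "(nat \<Rightarrow> tm) \<Rightarrow> tm \<Rightarrow> tm" where
  "subst_tm \<sigma> (Var i) = \<sigma> i"
| "subst_tm \<sigma> (Fn f ts) = Fn f (map (subst_tm \<sigma>) ts)"

abbreviation lift_tm :: "tm \<Rightarrow> tm" where "lift_tm \<equiv> subst_tm (\<lambda>i. Var (Suc i))"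

primrec subst :: "(nat \<Rightarrow> tm) \<Rightarrow> fm \<Rightarrow> fm" where
  "subst \<sigma> Fls = Fls"
| "subst \<sigma> (Eq s t) = Eq (subst_tm \<sigma> s) (subst_tm \<sigma> t)"
| "subst \<sigma> (Rel r ts) = Rel r (map (subst_tm \<sigma>) ts)"
| "subst \<sigma> (Imp \<phi> \<psi>) = Imp (subst \<sigma> \<phi>) (subst \<sigma> \<psi>)"
| "subst \<sigma> (Forall \<phi>) = Forall (subst (case_nat (Var 0) (\<lambda>i. lift_tm (\<sigma> i))) \<phi>)"

abbreviation lift :: "fm \<Rightarrow> fm" where "lift \<equiv> subst (\<lambda>i. Var (Suc i))"
abbreviation subst0 :: "tm \<Rightarrow> fm \<Rightarrow> fm" where "subst0 t \<equiv> subst (case_nat t Var)"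

primrec fv_tm :: "tm \<Rightarrow> nat set" where
  "fv_tm (Var i) = {i}"
| "fv_tm (Fn f ts) = \<Union>(set (map fv_tm ts))"

primrec fv :: "fm \<Rightarrow> nat set" where
  "fv Fls = {}"
| "fv (Eq s t) = fv_tm s \<union> fv_tm t"
| "fv (Rel r ts) = \<Union>(set (map fv_tm ts))"
| "fv (Imp \<phi> \<psi>) = fv \<phi> \<union> fv \<psi>"
| "fv (Forall \<phi>) = {i. Suc i \<in> fv \<phi>}"

record fo_theory =
  funs :: "(nat \<times> nat) set"
  rels :: "(nat \<times> nat) set"
  axioms :: "fm set"

primrec wf_tm :: "fo_theory \<Rightarrow> tm \<Rightarrow> bool" where
  "wf_tm T (Var i) \<longleftrightarrow> True"
| "wf_tm T (Fn f ts) \<longleftrightarrow> (f, length ts) \<in> funs T \<and> list_all (wf_tm T) ts"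

primrec wf_fm :: "fo_theory \<Rightarrow> fm \<Rightarrow> bool" where
  "wf_fm T Fls \<longleftrightarrow> True"
| "wf_fm T (Eq s t) \<longleftrightarrow> wf_tm T s \<and> wf_tm T t"
| "wf_fm T (Rel r ts) \<longleftrightarrow> (r, length ts) \<in> rels T \<and> list_all (wf_tm T) ts"
| "wf_fm T (Imp \<phi> \<psi>) \<longleftrightarrow> wf_fm T \<phi> \<and> wf_fm T \<psi>"
| "wf_fm T (Forall \<phi>) \<longleftrightarrow> wf_fm T \<phi>"

definition sentence :: "fo_theory \<Rightarrow> fm \<Rightarrow> bool" where
  "sentence T \<phi> \<longleftrightarrow> wf_fm T \<phi> \<and> fv \<phi> = {}"

text \<open>Classical natural deduction in the language of \<open>T\<close>; the axioms of \<open>T\<close> are not used here.\<close>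

inductive derives :: "fo_theory \<Rightarrow> fm set \<Rightarrow> fm \<Rightarrow> bool" for T where
  Assm: "\<phi> \<in> \<Gamma> \<Longrightarrow> derives T \<Gamma> \<phi>"
| ImpI: "wf_fm T \<phi> \<Longrightarrow> derives T (insert \<phi> \<Gamma>) \<psi> \<Longrightarrow> derives T \<Gamma> (Imp \<phi> \<psi>)"
| ImpE: "derives T \<Gamma> (Imp \<phi> \<psi>) \<Longrightarrow> derives T \<Gamma> \<phi> \<Longrightarrow> derives T \<Gamma> \<psi>"
| Contr: "wf_fm T \<phi> \<Longrightarrow> derives T (insert (Neg \<phi>) \<Gamma>) Fls \<Longrightarrow> derives T \<Gamma> \<phi>"
| AllI: "derives T (lift ` \<Gamma>) \<phi> \<Longrightarrow> derives T \<Gamma> (Forall \<phi>)"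
| AllE: "derives T \<Gamma> (Forall \<phi>) \<Longrightarrow> wf_tm T t \<Longrightarrow> derives T \<Gamma> (subst0 t \<phi>)"
| EqI: "wf_tm T t \<Longrightarrow> derives T \<Gamma> (Eq t t)"
| EqE: "derives T \<Gamma> (Eq s t) \<Longrightarrow> derives T \<Gamma> (subst0 s \<phi>) \<Longrightarrow> derives T \<Gamma> (subst0 t \<phi>)"

abbreviation provable :: "fo_theory \<Rightarrow> fm \<Rightarrow> bool" (infix "\<turnstile>" 50) where
  "T \<turnstile> \<phi> \<equiv> derives T (axioms T) \<phi>"

definition is_theory :: "fo_theory \<Rightarrow> bool" where
  "is_theory T \<longleftrightarrow> (\<forall>\<phi>\<in>axioms T. sentence T \<phi>)"

definition consistent :: "fo_theory \<Rightarrow> bool" where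
  "consistent T \<longleftrightarrow> \<not> T \<turnstile> Fls"

section \<open>Goedel numbering\<close>

primrec code_tm :: "tm \<Rightarrow> nat" where
  "code_tm (Var i) = prod_encode (0, i)"
| "code_tm (Fn f ts) = prod_encode (1, prod_encode (f, list_encode (map code_tm ts)))"

primrec code :: "fm \<Rightarrow> nat" where
  "code Fls = prod_encode (0, 0)"
| "code (Eq s t) = prod_encode (1, prod_encode (code_tm s, code_tm t))"
| "code (Rel r ts) = prod_encode (2, prod_encode (r, list_encode (map code_tm ts)))"
| "code (Imp \<phi> \<psi>) = prod_encode (3, prod_encode (code \<phi>, code \<psi>))"
| "code (Forall \<phi>) = prod_encode (4, code \<phi>)"

lemma code_tm_inj: "code_tm s = code_tm t \<Longrightarrow> s = t"
proof (induction s arbitrary: t)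
  case (Var i) then show ?case by (cases t) auto
next
  case (Fn f ts)
  from Fn.prems obtain us where t: "t = Fn f us" and eq: "map code_tm ts = map code_tm us"
    by (cases t) (auto dest: inj_list_encode[THEN injD])
  have "ts = us"
    using map_eq_imp_length_eq[OF eq] eq Fn.IH
    by (intro nth_equalityI) (auto simp: list_eq_iff_nth_eq)
  with t show ?case by simp
qed

lemma code_inj: "code \<phi> = code \<psi> \<Longrightarrow> \<phi> = \<psi>"
proof (induction \<phi> arbitrary: \<psi>)
  case (Rel r ts)
  have "inj code_tm" by (auto intro: injI code_tm_inj)
  with Rel show ?case by (cases \<psi>) (auto dest: inj_list_encode[THEN injD])
qed (case_tac \<psi>; auto dest: code_tm_inj)+

definition re_theory :: "fo_theory \<Rightarrow> bool" where
  "re_theory T \<longleftrightarrow> is_theory T \<and> re_rel 1 {[code \<phi>] | \<phi>. \<phi> \<in> axioms T}"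

section \<open>Translations and interpretations\<close>

text \<open>
  One-dimensional parameter-free translations; equality is translated like a relation symbol.
  The translation of a \<open>k\<close>-ary function symbol \<open>f\<close> has the arguments as variables \<open>0, \<dots>, k - 1\<close>
  and the value as variable \<open>k\<close>.
\<close>

record translation =
  dom_tr :: fm
  eq_tr :: fm
  fun_tr :: "nat \<Rightarrow> nat \<Rightarrow> fm"
  rel_tr :: "nat \<Rightarrow> nat \<Rightarrow> fm"

definition is_translation :: "translation \<Rightarrow> fo_theory \<Rightarrow> fo_theory \<Rightarrow> bool" where
  "is_translation I S T \<longleftrightarrow>
     wf_fm T (dom_tr I) \<and> fv (dom_tr I) \<subseteq> {..<1} \<and>
     wf_fm T (eq_tr I) \<and> fv (eq_tr I) \<subseteq> {..<2} \<and>
     (\<forall>(f, k) \<in> funs S. wf_fm T (fun_tr I f k) \<and> fv (fun_tr I f k) \<subseteq> {..<Suc k}) \<and>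
     (\<forall>(r, k) \<in> rels S. wf_fm T (rel_tr I r k) \<and> fv (rel_tr I r k) \<subseteq> {..<k})"

lemma size_lift_tm [simp]: "size (lift_tm t) = size t"
  by (induction t) (auto simp: size_list_conv_sum_list comp_def intro!: arg_cong[where f = sum_list])

lemma size_list_lift_tm [simp]: "size_list (size \<circ> lift_tm) ts = size_list size ts"
  by (induction ts) auto

text \<open>
  \<open>tr_atom I \<chi> vs ts\<close> is the translation of the atomic formula \<open>P(vs, ts)\<close>, where \<open>\<chi>\<close> is the
  translation of \<open>P\<close> and the arguments \<open>vs\<close> have been processed and are variables. A compound
  argument \<open>f(us)\<close> is replaced by a new variable \<open>z\<close> in the domain with \<open>f(us) = z\<close>.
\<close>

function tr_atom :: "translation \<Rightarrow> fm \<Rightarrow> nat list \<Rightarrow> tm list \<Rightarrow> fm" where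
  "tr_atom I \<chi> vs [] = subst (\<lambda>i. Var (vs ! i)) \<chi>"
| "tr_atom I \<chi> vs (Var x # ts) = tr_atom I \<chi> (vs @ [x]) ts"
| "tr_atom I \<chi> vs (Fn f us # ts) =
     Exists (And (dom_tr I)
        (And (tr_atom I (fun_tr I f (length us)) [] (map lift_tm us @ [Var 0]))
             (tr_atom I \<chi> (map Suc vs @ [0]) (map lift_tm ts))))"
  by pat_completeness auto
termination
  by (relation "measure (\<lambda>(I, \<chi>, vs, ts). size_list size ts)") auto

fun tr_eq :: "translation \<Rightarrow> tm \<Rightarrow> tm \<Rightarrow> fm" where
  "tr_eq I (Fn f us) (Var y) = tr_atom I (fun_tr I f (length us)) [] (us @ [Var y])"
| "tr_eq I s t = tr_atom I (eq_tr I) [] [s, t]"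

primrec tr :: "translation \<Rightarrow> fm \<Rightarrow> fm" where
  "tr I Fls = Fls"
| "tr I (Eq s t) = tr_eq I s t"
| "tr I (Rel r ts) = tr_atom I (rel_tr I r (length ts)) [] ts"
| "tr I (Imp \<phi> \<psi>) = Imp (tr I \<phi>) (tr I \<psi>)"
| "tr I (Forall \<phi>) = Forall (Imp (dom_tr I) (tr I \<phi>))"

text \<open>Totality of the translation of a \<open>k\<close>-ary \<open>f\<close>: for all \<open>x\<^sub>0, \<dots>, x\<^sub>k\<^sub>-\<^sub>1\<close> in the domain there is
  a value in the domain (variable \<open>0\<close> under the existential quantifier).\<close>

definition fun_total :: "translation \<Rightarrow> nat \<Rightarrow> nat \<Rightarrow> fm" where
  "fun_total I f k =
     (Forall ^^ k) (foldr (\<lambda>i \<psi>. Imp (subst (\<lambda>_. Var i) (dom_tr I)) \<psi>) [0..<k]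
       (Exists (And (dom_tr I)
                (subst (\<lambda>i. if i < k then Var (Suc i) else Var 0) (fun_tr I f k)))))"

text \<open>Equality is logical here, so the equality axioms are among the theorems of \<open>S\<close>.\<close>

definition interpretation_in :: "translation \<Rightarrow> fo_theory \<Rightarrow> fo_theory \<Rightarrow> bool" where
  "interpretation_in I S T \<longleftrightarrow>
     is_translation I S T \<and>
     (\<forall>(f, k) \<in> funs S. T \<turnstile> fun_total I f k) \<and>
     (\<forall>\<phi>. sentence S \<phi> \<longrightarrow> S \<turnstile> \<phi> \<longrightarrow> T \<turnstile> tr I \<phi>)"

definition is_identity_on :: "fo_theory \<Rightarrow> translation \<Rightarrow> bool" where
  "is_identity_on S I \<longleftrightarrow>
     dom_tr I = Eq (Var 0) (Var 0) \<and>
     eq_tr I = Eq (Var 0) (Var 1) \<and>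
     (\<forall>(f, k) \<in> funs S. fun_tr I f k = Eq (Fn f (map Var [0..<k])) (Var k)) \<and>
     (\<forall>(r, k) \<in> rels S. rel_tr I r k = Rel r (map Var [0..<k]))"

text \<open>An extension whose language has new relation symbols only.\<close>

definition relational_extension :: "fo_theory \<Rightarrow> fo_theory \<Rightarrow> bool" where
  "relational_extension T S \<longleftrightarrow>
     funs T = funs S \<and> rels S \<subseteq> rels T \<and> (\<forall>\<phi>\<in>axioms S. T \<turnstile> \<phi>)"

section \<open>The theory Num and Rosser theories\<close>

primrec num :: "nat \<Rightarrow> tm" where
  "num 0 = Fn 0 []"
| "num (Suc k) = Fn 1 [num k]"

definition Num :: fo_theory where
  "Num = \<lparr> funs = {(0, 0), (1, 1)}, rels = {},
           axioms = {Neg (Eq (num m) (num n)) | m n. m \<noteq> n} \<rparr>"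

definition num_interpretation :: "translation \<Rightarrow> fo_theory \<Rightarrow> bool" where
  "num_interpretation I T \<longleftrightarrow>
     interpretation_in I Num T \<and> (relational_extension T Num \<longrightarrow> is_identity_on Num I)"

text \<open>
  \<open>inst I \<phi> [a\<^sub>1, \<dots>, a\<^sub>k]\<close> is \<open>\<phi>(a\<^sub>1, \<dots>, a\<^sub>k)\<close> with the \<open>I\<close>-translations of the numerals for the
  variables \<open>0, \<dots>, k - 1\<close> of \<open>\<phi>\<close>. The translated numeral of \<open>a\<close> is not a term but is described by
  the translation of \<open>num a = x\<close>; it is eliminated in the usual way, an existential
  quantifier over \<open>x\<close> in the domain having the whole of \<open>\<phi>\<close> as its scope. Binding variable \<open>0\<close>
  moves the remaining variables down by one.
\<close>

primrec inst :: "translation \<Rightarrow> fm \<Rightarrow> nat list \<Rightarrow> fm" where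
  "inst I \<phi> [] = \<phi>"
| "inst I \<phi> (a # as) = inst I (Exists (And (dom_tr I) (And (tr I (Eq (num a) (Var 0))) \<phi>))) as"

definition strongly_separates ::
    "fo_theory \<Rightarrow> translation \<Rightarrow> nat \<Rightarrow> fm \<Rightarrow> nat list set \<Rightarrow> nat list set \<Rightarrow> bool" where
  "strongly_separates T I k \<phi> M\<^sub>1 M\<^sub>2 \<longleftrightarrow>
     wf_fm T \<phi> \<and> fv \<phi> = {..<k} \<and>
     (\<forall>as\<in>M\<^sub>1. T \<turnstile> inst I \<phi> as) \<and>
     (\<forall>as\<in>M\<^sub>2. T \<turnstile> Neg (inst I \<phi> as))"

definition rosser :: "nat \<Rightarrow> fo_theory \<Rightarrow> bool" where
  "rosser k T \<longleftrightarrow>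
     (\<exists>I. num_interpretation I T \<and>
       (\<forall>M\<^sub>1 M\<^sub>2. re_rel k M\<^sub>1 \<longrightarrow> re_rel k M\<^sub>2 \<longrightarrow>
          (\<exists>\<phi>. strongly_separates T I k \<phi> (M\<^sub>1 - M\<^sub>2) (M\<^sub>2 - M\<^sub>1))))"

definition effectively_rosser ::
    "(nat \<Rightarrow> nat \<Rightarrow> nat list set) \<Rightarrow> nat \<Rightarrow> fo_theory \<Rightarrow> bool" where
  "effectively_rosser R n T \<longleftrightarrow>
     (\<exists>I f. num_interpretation I T \<and> recursive_fun 2 f \<and>
       (\<forall>i j. \<exists>\<phi>. f [i, j] = code \<phi> \<and>
          strongly_separates T I n \<phi> (R n i - R n j) (R n j - R n i)))"

end

theory Submission
  imports Defs
begin

text \<open>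
  Code the pair \<open>(i, j)\<close> by a single number \<open>a\<close>. The sets of all \<open>a # xs\<close> with \<open>xs \<in> R n i\<close> and
  with \<open>xs \<in> R n j\<close>, respectively, are \<open>(n + 1)\<close>-ary RE relations, so some formula \<open>\<phi>\<close> strongly
  separates their differences. Instantiating the first variable of \<open>\<phi>\<close> with the numeral of \<open>a\<close>
  gives a formula for the pair \<open>(i, j)\<close>. The translation of \<open>num (Suc a) = x\<close> arises from that of
  \<open>num a = x\<close> by a fixed syntactic operation, so the code of this formula is primitive recursive in \<open>a\<close>.
\<close>

section \<open>Closure properties of recursive functions\<close>

lemma recursive_fun_cong:
  assumes "\<And>xs. length xs = k \<Longrightarrow> f xs = g xs"
  shows "recursive_fun k f \<longleftrightarrow> recursive_fun k g"
  using assms unfolding recursive_fun_def by metis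

text \<open>Determinism forces the intermediate list to be \<open>ys\<close>. Being an equivalence,
  this also transfers divergence of \<open>p\<close>, as needed for domains.\<close>

lemma computes_Comp_total:
  assumes "\<And>i. i < length ps \<Longrightarrow> computes (ps ! i) xs (ys ! i)" and "length ys = length ps"
  shows "computes (Comp p ps) xs z \<longleftrightarrow> computes p ys z"
proof
  assume "computes (Comp p ps) xs z"
  then obtain ys' where ys': "length ys' = length ps"
    "\<And>i. i < length ps \<Longrightarrow> computes (ps ! i) xs (ys' ! i)" "computes p ys' z"
    by (auto elim: computes.cases)
  then have "ys' = ys"
    using assms by (intro nth_equalityI) (auto intro: computes_deterministic)
  with ys' show "computes p ys z" by simp
next
  assume "computes p ys z"
  then show "computes (Comp p ps) xs z" using assms by (auto intro: computes.Comp)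
qed

lemma recursive_funs_programs:
  assumes "\<And>g. g \<in> set gs \<Longrightarrow> recursive_fun k g"
  obtains ps where "length ps = length gs"
    "\<And>i xs. i < length gs \<Longrightarrow> length xs = k \<Longrightarrow> computes (ps ! i) xs ((gs ! i) xs)"
proof -
  have "\<forall>i<length gs. \<exists>p. \<forall>xs. length xs = k \<longrightarrow> computes p xs ((gs ! i) xs)"
    using assms unfolding recursive_fun_def by auto
  then obtain P where "\<forall>i<length gs. \<forall>xs. length xs = k \<longrightarrow> computes (P i) xs ((gs ! i) xs)"
    by metis
  then show thesis by (intro that[of "map P [0..<length gs]"]) auto
qed

lemma recursive_fun_comp:
  assumes "recursive_fun (length gs) f" and "\<And>g. g \<in> set gs \<Longrightarrow> recursive_fun k g"
  shows "recursive_fun k (\<lambda>xs. f (map (\<lambda>g. g xs) gs))"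
proof -
  obtain p where p: "\<And>ys. length ys = length gs \<Longrightarrow> computes p ys (f ys)"
    using assms(1) unfolding recursive_fun_def by blast
  obtain ps where ps: "length ps = length gs"
    "\<And>i xs. i < length gs \<Longrightarrow> length xs = k \<Longrightarrow> computes (ps ! i) xs ((gs ! i) xs)"
    using recursive_funs_programs assms(2) by blast
  have "computes (Comp p ps) xs (f (map (\<lambda>g. g xs) gs))" if "length xs = k" for xs
    using p ps that by (subst computes_Comp_total[where ys = "map (\<lambda>g. g xs) gs"]) auto
  then show ?thesis unfolding recursive_fun_def by blast
qed

text \<open>Composing a program with domain \<open>M\<close> with programs for the total functions
  \<open>gs\<close> gives a program whose domain is the preimage.\<close>

lemma re_rel_preimage:
  assumes "re_rel (length gs) M" and "\<And>g. g \<in> set gs \<Longrightarrow> recursive_fun k g"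
  shows "re_rel k {xs. length xs = k \<and> map (\<lambda>g. g xs) gs \<in> M}"
proof -
  obtain p where M: "M = {ys. length ys = length gs \<and> (\<exists>z. computes p ys z)}"
    using assms(1) unfolding re_rel_def by blast
  obtain ps where ps: "length ps = length gs"
    "\<And>i xs. i < length gs \<Longrightarrow> length xs = k \<Longrightarrow> computes (ps ! i) xs ((gs ! i) xs)"
    using recursive_funs_programs assms(2) by blast
  have "computes (Comp p ps) xs z \<longleftrightarrow> computes p (map (\<lambda>g. g xs) gs) z" if "length xs = k" for xs z
    using ps that by (intro computes_Comp_total) auto
  then show ?thesis unfolding re_rel_def M by (intro exI[of _ "Comp p ps"]) auto
qed

lemma recursive_fun_nth: "i < k \<Longrightarrow> recursive_fun k (\<lambda>xs. xs ! i)"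
  unfolding recursive_fun_def by (metis computes.Proj)

lemma recursive_fun_Suc:
  assumes "recursive_fun k a"
  shows "recursive_fun k (\<lambda>xs. Suc (a xs))"
proof -
  have "computes Succ ys (Suc (hd ys))" if "length ys = 1" for ys
    using that by (cases ys) (auto intro: computes.Succ)
  then have "recursive_fun 1 (\<lambda>ys. Suc (hd ys))" unfolding recursive_fun_def by blast
  from recursive_fun_comp[of "[a]" "\<lambda>ys. Suc (hd ys)" k] this assms show ?thesis by simp
qed

lemma recursive_fun_const: "recursive_fun k (\<lambda>_. c)"
proof (induction c)
  case 0 show ?case unfolding recursive_fun_def by (blast intro: computes.Zero)
qed (rule recursive_fun_Suc)

text \<open>\<open>Prim\<close> recurses on the head of its argument list. So \<open>F\<close> of
  arity \<open>Suc k\<close> comes first and is then composed with \<open>a\<close> and the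
  \<open>k\<close> projections, which feed it \<open>a xs # xs\<close>.\<close>

lemma recursive_fun_rec_nat:
  assumes "recursive_fun k a" and "recursive_fun k g" and "recursive_fun (Suc (Suc k)) h"
  shows "recursive_fun k (\<lambda>xs. rec_nat (g xs) (\<lambda>m y. h (m # y # xs)) (a xs))"
proof -
  define F where "F ys = rec_nat (g (tl ys)) (\<lambda>m y. h (m # y # tl ys)) (hd ys)" for ys
  obtain p q where p: "\<And>xs. length xs = k \<Longrightarrow> computes p xs (g xs)"
    and q: "\<And>xs. length xs = Suc (Suc k) \<Longrightarrow> computes q xs (h xs)"
    using assms(2,3) unfolding recursive_fun_def by blast
  have "computes (Prim p q) (m # xs) (rec_nat (g xs) (\<lambda>m y. h (m # y # xs)) m)"
    if "length xs = k" for xs m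
    using that p q by (induction m) (auto intro: computes.Prim0 computes.PrimS)
  then have "computes (Prim p q) ys (F ys)" if "length ys = Suc k" for ys
    using that unfolding F_def by (cases ys) auto
  then have F: "recursive_fun (Suc k) F" unfolding recursive_fun_def by blast
  have "map (\<lambda>i. xs ! i) [0..<k] = xs" if "length xs = k" for xs :: "nat list"
    using that map_nth by blast
  then have "map (\<lambda>f. f xs) (a # map (\<lambda>i xs. xs ! i) [0..<k]) = a xs # xs" if "length xs = k" for xs
    using that by (simp add: comp_def)
  moreover have "recursive_fun k (\<lambda>xs. F (map (\<lambda>f. f xs) (a # map (\<lambda>i xs. xs ! i) [0..<k])))"
    using F assms(1) by (intro recursive_fun_comp) (auto intro: recursive_fun_nth)
  ultimately show ?thesis
    by (subst recursive_fun_cong[where g = "\<lambda>xs. F (map (\<lambda>f. f xs) (a # map (\<lambda>i xs. xs ! i) [0..<k]))"])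
      (simp_all add: F_def)
qed

lemma recursive_fun_Least:
  assumes "recursive_fun (Suc k) g" and "\<And>xs. length xs = k \<Longrightarrow> \<exists>m. g (m # xs) = 0"
  shows "recursive_fun k (\<lambda>xs. LEAST m. g (m # xs) = 0)"
proof -
  obtain p where p: "\<And>xs. length xs = Suc k \<Longrightarrow> computes p xs (g xs)"
    using assms(1) unfolding recursive_fun_def by blast
  have "computes (Mu p) xs (LEAST m. g (m # xs) = 0)" if len: "length xs = k" for xs
  \<comment> \<open>\<open>Mu\<close> wants values of the form \<open>Suc (h m)\<close> below the
    result, so \<open>h\<close> is the predecessor of the nonzero values of
    \<open>g\<close>.\<close>
  proof (rule computes.Mu[where h = "\<lambda>m. g (m # xs) - 1"])
    have "g ((LEAST m. g (m # xs) = 0) # xs) = 0" using assms(2)[OF len] by (rule LeastI_ex)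
    with p show "computes p ((LEAST m. g (m # xs) = 0) # xs) 0" by (metis len length_Cons)
  next
    fix m assume "m < (LEAST m. g (m # xs) = 0)"
    then have "g (m # xs) \<noteq> 0" by (rule not_less_Least)
    with p[of "m # xs"] len show "computes p (m # xs) (Suc (g (m # xs) - 1))" by simp
  qed
  then show ?thesis unfolding recursive_fun_def by blast
qed

section \<open>Arithmetic and the pairing function\<close>

lemma recursive_fun_add:
  assumes "recursive_fun k a" and "recursive_fun k b"
  shows "recursive_fun k (\<lambda>xs. a xs + b xs)"
proof -
  have "rec_nat x (\<lambda>_. Suc) y = x + y" for x y by (induction y) auto
  \<comment> \<open>The step function receives \<open>m # y # xs\<close>: entry 0 is the counter,
    entry 1 the previous value.\<close>
  then show ?thesis
    using recursive_fun_rec_nat[OF assms(2,1), of "\<lambda>zs. Suc (zs ! 1)"]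
    by (simp add: recursive_fun_Suc recursive_fun_nth)
qed

lemma recursive_fun_pred:
  assumes "recursive_fun k a"
  shows "recursive_fun k (\<lambda>xs. a xs - 1)"
proof -
  have "rec_nat 0 (\<lambda>m _. m) x = x - 1" for x :: nat by (cases x) auto
  then show ?thesis
    using recursive_fun_rec_nat[OF assms recursive_fun_const[of _ 0], of "\<lambda>zs. zs ! 0"]
    by (simp add: recursive_fun_nth)
qed

lemma recursive_fun_diff:
  assumes "recursive_fun k a" and "recursive_fun k b"
  shows "recursive_fun k (\<lambda>xs. a xs - b xs)"
proof -
  have "rec_nat x (\<lambda>_ z. z - 1) y = x - y" for x y :: nat by (induction y) auto
  then show ?thesis
    using recursive_fun_rec_nat[OF assms(2,1), of "\<lambda>zs. zs ! 1 - 1"]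
    by (simp add: recursive_fun_pred[simplified] recursive_fun_nth)
qed

lemma recursive_fun_triangle:
  assumes "recursive_fun k a"
  shows "recursive_fun k (\<lambda>xs. triangle (a xs))"
proof -
  have "rec_nat 0 (\<lambda>m y. y + Suc m) x = triangle x" for x by (induction x) auto
  then show ?thesis
    using recursive_fun_rec_nat[OF assms recursive_fun_const[of _ 0], of "\<lambda>zs. zs ! 1 + Suc (zs ! 0)"]
    by (simp add: recursive_fun_add recursive_fun_Suc recursive_fun_nth del: add_Suc_right)
qed

lemma recursive_fun_prod_encode:
  assumes "recursive_fun k a" and "recursive_fun k b"
  shows "recursive_fun k (\<lambda>xs. prod_encode (a xs, b xs))"
  unfolding prod_encode_def
  using assms by (simp add: recursive_fun_add recursive_fun_triangle)

lemma triangle_mono: "m \<le> n \<Longrightarrow> triangle m \<le> triangle n"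
  by (induction rule: dec_induct) auto

lemma triangle_ge: "n \<le> triangle n"
  by (induction n) auto

text \<open>\<open>prod_encode (i, j)\<close> lies between \<open>triangle (i + j)\<close> and \<open>triangle (i + j + 1)\<close>.\<close>

lemma Least_triangle_prod_encode:
  "(LEAST m. Suc (prod_encode (i, j)) - triangle (Suc m) = 0) = i + j"
proof (rule Least_equality)
  show "Suc (prod_encode (i, j)) - triangle (Suc (i + j)) = 0" by (simp add: prod_encode_def)
next
  fix m assume *: "Suc (prod_encode (i, j)) - triangle (Suc m) = 0"
  show "i + j \<le> m"
  proof (rule ccontr)
    assume "\<not> i + j \<le> m"
    then have "triangle (Suc m) \<le> triangle (i + j)" by (intro triangle_mono) simp
    with * show False by (simp add: prod_encode_def)
  qed
qed

text \<open>Since \<open>prod_encode (i, j)\<close> is \<open>triangle (i + j) + i\<close>, a search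
  for the diagonal \<open>i + j\<close> suffices; subtraction then yields both components.\<close>

lemma recursive_fun_prod_decode:
  assumes "recursive_fun k a"
  shows "recursive_fun k (\<lambda>xs. fst (prod_decode (a xs)))"
    and "recursive_fun k (\<lambda>xs. snd (prod_decode (a xs)))"
proof -
  define s where "s x = (LEAST m. Suc x - triangle (Suc m) = 0)" for x
  have s_encode: "s (prod_encode (i, j)) = i + j" for i j
    unfolding s_def by (rule Least_triangle_prod_encode)
  have fst_eq: "fst (prod_decode x) = x - triangle (s x)"
    and snd_eq: "snd (prod_decode x) = s x - fst (prod_decode x)" for x
  proof -
    obtain i j where x: "x = prod_encode (i, j)"
      by (metis prod_decode_inverse surj_pair)
    show "fst (prod_decode x) = x - triangle (s x)"
      "snd (prod_decode x) = s x - fst (prod_decode x)"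
      unfolding x s_encode prod_encode_inverse by (simp_all add: prod_encode_def)
  qed
  have "recursive_fun 1 (\<lambda>xs. LEAST m. Suc ((m # xs) ! 1) - triangle (Suc ((m # xs) ! 0)) = 0)"
  proof (rule recursive_fun_Least[where g = "\<lambda>zs. Suc (zs ! 1) - triangle (Suc (zs ! 0))"])
    fix xs :: "nat list"
    show "\<exists>m. Suc ((m # xs) ! 1) - triangle (Suc ((m # xs) ! 0)) = 0"
      \<comment> \<open>The search for the diagonal of \<open>x\<close> stops at \<open>x\<close> at
        the latest, as \<open>Suc x \<le> triangle (Suc x)\<close>.\<close>
      using triangle_ge[of "Suc (xs ! 0)"] by (intro exI[of _ "xs ! 0"]) simp
  qed (intro recursive_fun_diff recursive_fun_triangle recursive_fun_Suc recursive_fun_nth; simp)+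
  then have "recursive_fun 1 (\<lambda>xs. s (xs ! 0))" by (simp add: s_def)
  then have s: "recursive_fun k (\<lambda>xs. s (a xs))"
    using recursive_fun_comp[of "[a]" "\<lambda>xs. s (xs ! 0)" k] assms by simp
  show fst: "recursive_fun k (\<lambda>xs. fst (prod_decode (a xs)))"
    unfolding fst_eq by (intro recursive_fun_diff recursive_fun_triangle s assms)
  show "recursive_fun k (\<lambda>xs. snd (prod_decode (a xs)))"
    unfolding snd_eq by (intro recursive_fun_diff s fst)
qed

section \<open>Translated numerals\<close>

lemma wf_subst_tm: "wf_tm T t \<Longrightarrow> (\<And>i. wf_tm T (\<sigma> i)) \<Longrightarrow> wf_tm T (subst_tm \<sigma> t)"
  by (induction t) (auto simp: list_all_iff)

lemma wf_subst: "wf_fm T \<phi> \<Longrightarrow> (\<And>i. wf_tm T (\<sigma> i)) \<Longrightarrow> wf_fm T (subst \<sigma> \<phi>)"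
proof (induction \<phi> arbitrary: \<sigma>)
  case (Forall \<phi>)
  have "wf_tm T (case i of 0 \<Rightarrow> Var 0 | Suc j \<Rightarrow> lift_tm (\<sigma> j))" for i
    using Forall.prems(2) by (cases i) (auto intro: wf_subst_tm)
  with Forall show ?case by simp
qed (auto simp: list_all_iff intro: wf_subst_tm)

lemma fv_subst_tm: "fv_tm (subst_tm \<sigma> t) = (\<Union>i\<in>fv_tm t. fv_tm (\<sigma> i))"
  by (induction t) auto

lemma fv_subst: "fv (subst \<sigma> \<phi>) = (\<Union>i\<in>fv \<phi>. fv_tm (\<sigma> i))"
proof (induction \<phi> arbitrary: \<sigma>)
  case (Forall \<phi>)
  have "j \<in> fv (subst \<sigma> (Forall \<phi>)) \<longleftrightarrow> j \<in> (\<Union>i\<in>fv (Forall \<phi>). fv_tm (\<sigma> i))" for j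
  proof -
    \<comment> \<open>Under the binder, index 0 contributes only the bound variable; the other
      indices contribute shifted variables.\<close>
    have "Suc j \<in> fv_tm (case i of 0 \<Rightarrow> Var 0 | Suc i' \<Rightarrow> lift_tm (\<sigma> i'))
        \<longleftrightarrow> (\<exists>i'. i = Suc i' \<and> j \<in> fv_tm (\<sigma> i'))" for i
      by (cases i) (auto simp: fv_subst_tm)
    then show ?thesis by (auto simp: Forall.IH)
  qed
  then show ?case by blast
qed (auto simp: fv_subst_tm)

lemma subst_tm_num [simp]: "subst_tm \<sigma> (num a) = num a"
  by (induction a) auto

lemma tr_num_0: "tr I (Eq (num 0) (Var 0)) = subst (\<lambda>i. Var ([0] ! i)) (fun_tr I 0 0)"
  by simp

text \<open>The new variable for the argument \<open>num a\<close> is again variable 0, and lifting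
  leaves the closed numeral unchanged, so the translation for \<open>a\<close> recurs verbatim. The
  case split exposes the head symbol of \<open>num a\<close>.\<close>

lemma tr_num_Suc:
  "tr I (Eq (num (Suc a)) (Var 0)) =
     Exists (And (dom_tr I) (And (tr I (Eq (num a) (Var 0)))
       (subst (\<lambda>i. Var ([0, 1] ! i)) (fun_tr I 1 1))))"
  by (cases a) auto

lemma
  assumes "is_translation I Num T"
  shows wf_tr_num: "wf_fm T (tr I (Eq (num a) (Var 0)))"
    and fv_tr_num: "fv (tr I (Eq (num a) (Var 0))) \<subseteq> {0}"
proof -
  have *: "wf_fm T (dom_tr I)" "fv (dom_tr I) \<subseteq> {0}"
    "wf_fm T (fun_tr I 0 0)" "fv (fun_tr I 0 0) \<subseteq> {0}"
    "wf_fm T (fun_tr I 1 1)" "fv (fun_tr I 1 1) \<subseteq> {0, 1}"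
    using assms unfolding is_translation_def Num_def by (auto simp: lessThan_Suc)
  have "wf_fm T (tr I (Eq (num a) (Var 0))) \<and> fv (tr I (Eq (num a) (Var 0))) \<subseteq> {0}"
  proof (induction a)
    case 0
    show ?case unfolding tr_num_0 fv_subst using * by (auto intro!: wf_subst)
  next
    case (Suc a)
    have "wf_fm T (subst (\<lambda>i. Var ([0, 1] ! i)) (fun_tr I 1 1))"
      using *(5) by (rule wf_subst) simp
    moreover have "fv (subst (\<lambda>i. Var ([0, 1] ! i)) (fun_tr I 1 1)) \<subseteq> {0, 1}"
      unfolding fv_subst using *(6) by auto
    \<comment> \<open>The quantifier binds the intermediate value 0 and turns the result variable 1
      into 0.\<close>
    ultimately show ?case
      unfolding tr_num_Suc using Suc *(1,2) by (simp del: tr.simps num.simps) auto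
  qed
  then show "wf_fm T (tr I (Eq (num a) (Var 0)))" "fv (tr I (Eq (num a) (Var 0))) \<subseteq> {0}"
    by blast+
qed

section \<open>Codes of translated numerals\<close>

lemma recursive_fun_code_Imp:
  assumes "recursive_fun k (\<lambda>xs. code (a xs))" and "recursive_fun k (\<lambda>xs. code (b xs))"
  shows "recursive_fun k (\<lambda>xs. code (Imp (a xs) (b xs)))"
  using assms by (auto intro!: recursive_fun_prod_encode recursive_fun_const)

lemma recursive_fun_code_tr_num:
  assumes "recursive_fun k a"
  shows "recursive_fun k (\<lambda>xs. code (tr I (Eq (num (a xs)) (Var 0))))"
proof -
  \<comment> \<open>\<open>c\<close> codes negation. In \<open>h\<close>, which is
    \<open>tr_num_Suc\<close> on codes, the tags 3 and 4 belong to \<open>Imp\<close> and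
    \<open>Forall\<close>; all ingredients from \<open>I\<close> are constants.\<close>
  define c where "c y = prod_encode (3, prod_encode (y, code Fls))" for y
  define B where "B = code (Neg (subst (\<lambda>i. Var ([0, 1] ! i)) (fun_tr I 1 1)))"
  define h where "h y = c (prod_encode (4, c (c (prod_encode (3, prod_encode (code (dom_tr I),
    c (c (prod_encode (3, prod_encode (y, B))))))))))" for y
  have "code (tr I (Eq (num m) (Var 0))) =
      rec_nat (code (tr I (Eq (num 0) (Var 0)))) (\<lambda>_. h) m" for m
  proof (induction m)
    case (Suc m)
    then show ?case
      unfolding tr_num_Suc by (simp add: h_def c_def B_def del: tr.simps num.simps)
  qed simp
  moreover have "recursive_fun (Suc (Suc k)) (\<lambda>zs. h (zs ! 1))"
    unfolding h_def c_def
    by (intro recursive_fun_prod_encode recursive_fun_const recursive_fun_nth) simp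
  ultimately show ?thesis
    using recursive_fun_rec_nat[OF assms recursive_fun_const, of "\<lambda>zs. h (zs ! 1)"] by simp
qed

section \<open>Rosser theories\<close>

theorem theorem5p4:
  fixes T :: fo_theory and R :: "nat \<Rightarrow> nat \<Rightarrow> nat list set" and n :: nat
  assumes "acceptable_enumeration R"
    and "re_theory T" and "consistent T"
    and "n \<ge> 1"
    and "rosser (n + 1) T"
  shows "effectively_rosser R n T"
proof -
  have "range (R n) = {M. re_rel n M}"
    and re_U: "re_rel (Suc n) {i # xs | i xs. xs \<in> R n i}" (is "re_rel _ ?U")
    using assms(1,4) unfolding acceptable_enumeration_def by simp_all
  then have re_R: "re_rel n (R n i)" for i by blast
  have len_R: "length xs = n" if "xs \<in> R n i" for xs i
    using re_R[of i] that unfolding re_rel_def by blast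
  define M where "M d = {a # xs | a xs. xs \<in> R n (d (prod_decode a))}" for d :: "nat \<times> nat \<Rightarrow> nat"
  have re_M: "re_rel (n + 1) (M d)" if d: "recursive_fun (n + 1) (\<lambda>xs. d (prod_decode (xs ! 0)))" for d
  proof -
    \<comment> \<open>These functions send \<open>a # ys\<close> to
      \<open>d (prod_decode a) # ys\<close>, which makes \<open>M d\<close> a preimage of the
      universal relation \<open>?U\<close>.\<close>
    let ?gs = "(\<lambda>xs. d (prod_decode (xs ! 0))) # map (\<lambda>i xs. xs ! Suc i) [0..<n]"
    have "re_rel (n + 1) {xs. length xs = n + 1 \<and> map (\<lambda>g. g xs) ?gs \<in> ?U}"
      using re_U d by (intro re_rel_preimage) (auto intro: recursive_fun_nth)
    also have "{xs. length xs = n + 1 \<and> map (\<lambda>g. g xs) ?gs \<in> ?U} = M d"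
    proof -
      have *: "a # ys \<in> {xs. length xs = n + 1 \<and> map (\<lambda>g. g xs) ?gs \<in> ?U} \<longleftrightarrow> a # ys \<in> M d" for a ys
        using len_R[of ys] map_nth[of ys]
        by (cases "length ys = n") (auto simp: M_def comp_def)
      have "[] \<notin> M d" by (simp add: M_def)
      then have "xs \<in> {xs. length xs = n + 1 \<and> map (\<lambda>g. g xs) ?gs \<in> ?U} \<longleftrightarrow> xs \<in> M d" for xs
        using * by (cases xs) auto
      then show ?thesis by (rule set_eqI)
    qed
    finally show ?thesis .
  qed
  have "re_rel (n + 1) (M fst)" "re_rel (n + 1) (M snd)"
    by (rule re_M, rule recursive_fun_prod_decode, rule recursive_fun_nth, simp)+
  \<comment> \<open>This \<phi> is fixed before any \<open>i\<close> and \<open>j\<close>, so its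
    nonconstructive choice is harmless: its code is a constant.\<close>
  then obtain I \<phi> where I: "num_interpretation I T"
    and \<phi>: "strongly_separates T I (n + 1) \<phi> (M fst - M snd) (M snd - M fst)"
    using assms(5) unfolding rosser_def by blast
  then have tr: "is_translation I Num T"
    unfolding num_interpretation_def interpretation_in_def by blast
  \<comment> \<open>This is the first unfolding of \<open>inst\<close> at \<open>a\<close>, so
    instantiating \<psi> at \<open>as\<close> is instantiating \<phi> at
    \<open>a # as\<close>.\<close>
  define \<psi> where "\<psi> a = Exists (And (dom_tr I) (And (tr I (Eq (num a) (Var 0))) \<phi>))" for a
  have "recursive_fun 2 (\<lambda>xs. code (\<psi> (prod_encode (xs ! 0, xs ! 1))))"
  proof -
    have "recursive_fun 2 (\<lambda>xs. code (Forall (Neg (And (dom_tr I)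
        (And (tr I (Eq (num (prod_encode (xs ! 0, xs ! 1))) (Var 0))) \<phi>)))))"
      unfolding code.simps(5)
      by (intro recursive_fun_prod_encode recursive_fun_const recursive_fun_code_Imp
          recursive_fun_code_tr_num recursive_fun_nth) simp_all
    then show ?thesis
      unfolding \<psi>_def by (intro recursive_fun_code_Imp recursive_fun_const)
  qed
  moreover have "strongly_separates T I n (\<psi> (prod_encode (i, j))) (R n i - R n j) (R n j - R n i)" for i j
  proof -
    let ?a = "prod_encode (i, j)"
    have inst: "inst I (\<psi> ?a) as = inst I \<phi> (?a # as)" for as
      by (simp add: \<psi>_def)
    have M_iff: "?a # as \<in> M d \<longleftrightarrow> as \<in> R n (d (i, j))" for as d
      by (auto simp: M_def)
    have "wf_fm T (\<psi> ?a)"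
      using \<phi> tr wf_tr_num[OF tr, of ?a]
      by (simp add: \<psi>_def strongly_separates_def is_translation_def del: tr.simps)
    moreover have "fv (\<psi> ?a) = {..<n}"
    proof -
      have "fv (dom_tr I) \<subseteq> {0}" using tr by (auto simp: is_translation_def)
      \<comment> \<open>Binding variable 0 shifts the other variables of \<phi> down, leaving
        exactly \<open>n\<close>; the remaining conjuncts have at most variable 0 free.\<close>
      moreover have "fv \<phi> = {..<Suc n}" using \<phi> by (simp add: strongly_separates_def)
      ultimately show ?thesis
        using fv_tr_num[OF tr, of ?a] by (auto simp: \<psi>_def simp del: tr.simps)
    qed
    moreover have "T \<turnstile> inst I (\<psi> ?a) as" if "as \<in> R n i - R n j" for as
    proof -
      have "?a # as \<in> M fst - M snd" using that by (simp add: M_iff)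
      with \<phi> show ?thesis unfolding strongly_separates_def inst by blast
    qed
    moreover have "T \<turnstile> Neg (inst I (\<psi> ?a) as)" if "as \<in> R n j - R n i" for as
    proof -
      have "?a # as \<in> M snd - M fst" using that by (simp add: M_iff)
      with \<phi> show ?thesis unfolding strongly_separates_def inst by blast
    qed
    ultimately show ?thesis
      unfolding strongly_separates_def by blast
  qed
  ultimately show ?thesis
    using I unfolding effectively_rosser_def
    by (intro exI[of _ I] exI[of _ "\<lambda>xs. code (\<psi> (prod_encode (xs ! 0, xs ! 1)))"]) auto
qed

end
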